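(* Fix an integer $d\geq 1$. For integers $k\geq -1$, define the polynomial \[ p_{d,k}(n)=3d\binom{n+k}{1+k}+\sum_{i=1}^{k}(3i+2)\binom{n-1+k-i}{k-i} \] (so $p_{d,-1}(n)=3d$ and $p_{d,0}(n)=3dn$). Define a sequence $(a_m)_{m\geq 1}$ as follows: writing $m=3dn+r$ with integers $n\geq 0$ and $0\leq r<3d$, \[ a_{m}=\begin{cases} 3d-2 & \text{if } m=1,\\ 0 & \text{if } m=2,\\ p_{d,r/3}(n) & \text{if } r\equiv 0 \pmod 3,\\ 3d & \text{if } r\equiv 1 \pmod 3 \text{ and } m>2,\\ 3 & \text{if } r\equiv 2 \pmod 3,\ r\neq 3d-1, \text{ and } m>2,\\ 2 & \text{if } r=3d-1 \text{ and } m>2. \end{cases} \] Extend the sequence by setting $a_j=0$ for all integers $j\leq 0$. Then for every integer $m>3d+2$, \[ a_m=a_{m-a_{m-1}}+a_{m-a_{m-2}}, \] i.e. $(a_m)$ satisfies the Hofstadter $Q$-recurrence $Q(n)=Q(n-Q(n-1))+Q(n-Q(n-2))$ after an initial segment of length $3d+2$.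
   Context: Binomial coefficients are interpreted as polynomials in the top argument: for an integer $j\geq 0$, $\binom{x}{j}=\frac{x(x-1)\cdots(x-j+1)}{j!}$ (so, e.g., $\binom{-1}{0}=1$ and $\binom{k}{k+1}=0$ for integers $k\geq 0$). Convention: terms of the sequence at nonpositive indices are defined to be $0$. *)

theory Defs
  imports Complex_Main
begin

text \<open>The polynomial binomial coefficient at an integer argument, as an integer. The term
  constraint on \<open>(gchoose)\<close> excludes \<^typ>\<open>int\<close>, so the defining formula of \<open>(gchoose)\<close> is
  restated here; the division is exact, see \<open>of_int_int_gchoose\<close>.\<close>

definition int_gchoose :: "int \<Rightarrow> nat \<Rightarrow> int" (infix \<open>int'_gchoose\<close> 64) where
  "x int_gchoose j = (\<Prod>i = 0..<j. x - int i) div fact j"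

lemma of_int_int_gchoose: "of_int (x int_gchoose j) = (of_int x :: 'a :: field_char_0) gchoose j"
  using of_int_gbinomial[of x j] by (simp add: int_gchoose_def gbinomial_prod_rev[where 'a = int])

text \<open>Only \<open>k \<ge> -1\<close> is meaningful; then the arguments of \<open>nat\<close> below are nonnegative.\<close>

definition p_poly :: "int \<Rightarrow> int \<Rightarrow> int \<Rightarrow> int" where
  "p_poly d k n =
     3 * d * ((n + k) int_gchoose nat (1 + k))
     + (\<Sum>i = 1..k. (3 * i + 2) * ((n - 1 + k - i) int_gchoose nat (k - i)))"

lemma of_int_p_poly:
  "(of_int (p_poly d k n) :: 'a :: field_char_0) =
     3 * of_int d * (of_int (n + k) gchoose nat (1 + k))
     + (\<Sum>i = 1..k. (3 * of_int i + 2) * (of_int (n - 1 + k - i) gchoose nat (k - i)))"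
  by (simp add: p_poly_def of_int_int_gchoose)

lemma p_poly_minus_one: "p_poly d (- 1) n = 3 * d"
  by (simp add: p_poly_def int_gchoose_def)

lemma p_poly_zero: "p_poly d 0 n = 3 * d * n"
  by (simp add: p_poly_def int_gchoose_def)

definition a_seq :: "int \<Rightarrow> int \<Rightarrow> int" where
  "a_seq d m =
     (let n = m div (3 * d); r = m mod (3 * d) in
      if m \<le> 0 then 0
      else if m = 1 then 3 * d - 2
      else if m = 2 then 0
      else if r mod 3 = 0 then p_poly d (r div 3) n
      else if r mod 3 = 1 then 3 * d
      else if r \<noteq> 3 * d - 1 then 3
      else 2)"

end

theory Submission
  imports Defs
begin

text \<open>Write \<open>m = 3 * d * n + 3 * k + e\<close> with \<open>0 \<le> k < d\<close> and \<open>e \<in> {0, 1, 2}\<close>. For \<open>e = 0\<close> the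
  recurrence is Pascal's rule \<open>p\<^sub>k(n) = p\<^bsub>k-1\<^esub>(n) + p\<^sub>k(n - 1)\<close>. For \<open>e = 1, 2\<close> one of the two
  summands has index \<open>m - p\<^sub>k(n)\<close>; by the lower bound \<open>p\<^sub>k(n) \<ge> 3 * d * n + 3 * k + 2\<close> for \<open>k \<ge> 1\<close>
  this index is nonpositive, while for \<open>k = 0\<close> it is exactly \<open>e\<close>, which is what the exceptional
  values \<open>a\<^sub>1 = 3 * d - 2\<close> and \<open>a\<^sub>2 = 0\<close> are for.\<close>

lemma int_gchoose_0 [simp]: "x int_gchoose 0 = 1"
  by (simp add: int_gchoose_def)

text \<open>Pulled back from the generalized binomial over the reals, since \<open>of_int\<close> is
  injective.\<close>

lemma int_gchoose_Suc_Suc: "(x + 1) int_gchoose Suc j = (x int_gchoose j) + (x int_gchoose Suc j)"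
proof -
  have "real_of_int ((x + 1) int_gchoose Suc j) = of_int ((x int_gchoose j) + (x int_gchoose Suc j))"
    by (simp add: of_int_int_gchoose gbinomial_Suc_Suc)
  then show ?thesis by (simp only: of_int_eq_iff)
qed

lemma int_gchoose_pascal:
  assumes "j > 0"
  shows "x int_gchoose nat j = ((x - 1) int_gchoose nat (j - 1)) + ((x - 1) int_gchoose nat j)"
proof -
  have "nat j = Suc (nat (j - 1))" using assms by simp
  then show ?thesis using int_gchoose_Suc_Suc[of "x - 1" "nat (j - 1)"] by simp
qed

lemma int_gchoose_eq_0:
  assumes "0 \<le> x" "x < int j"
  shows "x int_gchoose j = 0"
proof -
  have "(\<Prod>i = 0..<j. x - int i) = 0"
    using assms by (intro prod_zero) (auto intro!: bexI[of _ "nat x"])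
  then show ?thesis by (simp only: int_gchoose_def div_0)
qed

lemma p_poly_rec:
  assumes "k \<ge> 1"
  shows "p_poly d k n = p_poly d (k - 1) n + p_poly d k (n - 1)"
proof -
  have *: "(n + k) int_gchoose nat (1 + k)
      = ((n + (k - 1)) int_gchoose nat (1 + (k - 1))) + ((n - 1 + k) int_gchoose nat (1 + k))"
    using int_gchoose_pascal[of "1 + k" "n + k"] assms by (simp add: algebra_simps)
  have top: "{1..k} = insert k {1..k - 1}" using assms by auto
  have "(\<Sum>i = 1..k - 1. (3 * i + 2) * ((n - 1 + k - i) int_gchoose nat (k - i)))
      = (\<Sum>i = 1..k - 1. (3 * i + 2) * ((n - 1 + (k - 1) - i) int_gchoose nat (k - 1 - i))
          + (3 * i + 2) * ((n - 1 - 1 + k - i) int_gchoose nat (k - i)))"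
  proof (rule sum.cong[OF refl])
    fix i assume "i \<in> {1..k - 1}"
    then have "(n - 1 + k - i) int_gchoose nat (k - i)
      = ((n - 1 + (k - 1) - i) int_gchoose nat (k - 1 - i))
          + ((n - 1 - 1 + k - i) int_gchoose nat (k - i))"
      using int_gchoose_pascal[of "k - i" "n - 1 + k - i"] by (simp add: algebra_simps)
    then show "(3 * i + 2) * ((n - 1 + k - i) int_gchoose nat (k - i))
      = (3 * i + 2) * ((n - 1 + (k - 1) - i) int_gchoose nat (k - 1 - i))
          + (3 * i + 2) * ((n - 1 - 1 + k - i) int_gchoose nat (k - i))"
      by (simp only: distrib_left)
  qed
  then show ?thesis
    unfolding p_poly_def * by (simp add: top sum.distrib distrib_left)
qed

text \<open>At \<open>n = 0\<close> every binomial has a nonnegative top below its lower index and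
  vanishes, except for \<open>i = k\<close>, where the top is -1 and the lower index 0.\<close>

lemma p_poly_at_0:
  assumes "k \<ge> 1"
  shows "p_poly d k 0 = 3 * k + 2"
proof -
  have "{1..k} = insert k {1..k - 1}" using assms by auto
  moreover have "(\<Sum>i = 1..k - 1. (3 * i + 2) * ((k - 1 - i) int_gchoose nat (k - i))) = 0"
    by (intro sum.neutral) (auto simp: int_gchoose_eq_0)
  ultimately show ?thesis
    using assms by (simp add: p_poly_def int_gchoose_eq_0)
qed

text \<open>Equality holds at \<open>n = 0\<close>. By \<open>p_poly_rec\<close>, going from
  \<open>n\<close> to \<open>n + 1\<close> adds \<open>p_poly d (k - 1) (n + 1)\<close>, which is at
  least \<open>3 * d\<close>: directly for \<open>k = 1\<close>, by the outer induction on
  \<open>k\<close> otherwise.\<close>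

lemma p_poly_lower_bound:
  assumes "d \<ge> 1" "k \<ge> 1" "n \<ge> 0"
  shows "p_poly d k n \<ge> 3 * d * n + 3 * k + 2"
  using assms(2,3)
proof (induction k arbitrary: n rule: int_ge_induct)
  case base
  show ?case using base
  proof (induction n rule: int_ge_induct)
    case base
    then show ?case by (simp add: p_poly_at_0)
  next
    case (step n)
    have "3 * d * (n + 1) \<ge> 3 * d" using assms(1) step.hyps by simp
    then show ?case
      using step p_poly_rec[of 1 d "n + 1"] by (simp add: p_poly_zero algebra_simps)
  qed
next
  case (step k)
  note lower = step.IH and k = step.hyps
  show ?case using \<open>n \<ge> 0\<close>
  proof (induction n rule: int_ge_induct)
    case base
    then show ?case using k by (simp add: p_poly_at_0)
  next
    case (step n)
    have "0 \<le> d * n" using assms(1) step.hyps by simp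
    then have "p_poly d k (n + 1) \<ge> 3 * d"
      using lower[of "n + 1"] step.hyps k by (simp add: algebra_simps)
    then show ?case
      using step p_poly_rec[of "k + 1" d "n + 1"] k by (simp add: algebra_simps)
  qed
qed

lemma a_seq_eq:
  fixes d n k e :: int
  assumes "0 \<le> n" "0 \<le> k" "k < d" "0 \<le> e" "e < 3" "3 * d * n + 3 * k + e > 2"
  shows "a_seq d (3 * d * n + 3 * k + e) =
    (if e = 0 then p_poly d k n else if e = 1 then 3 * d else if k = d - 1 then 2 else 3)"
proof -
  have "0 \<le> 3 * k + e" "3 * k + e < 3 * d" using assms by auto
  then have "(3 * d * n + 3 * k + e) div (3 * d) = n"
    "(3 * d * n + 3 * k + e) mod (3 * d) = 3 * k + e"
    using div_mult_self4[of "3 * d" n "3 * k + e"] by (simp_all add: add.assoc)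
  moreover have "(3 * k + e) mod 3 = e" "(3 * k + e) div 3 = k" using assms by auto
  ultimately show ?thesis
    using assms unfolding a_seq_def Let_def by auto
qed

text \<open>Off the multiples of 3 the value depends only on the residue modulo
  \<open>3 * d\<close>; the bound on \<open>m\<close> keeps \<open>m - 3 * d\<close> past the
  exceptional indices 1 and 2.\<close>

lemma a_seq_shift:
  fixes d m :: int
  assumes "d \<ge> 1" "m > 3 * d + 2" "m mod 3 \<noteq> 0"
  shows "a_seq d (m - 3 * d) = a_seq d m"
proof -
  have "(m - 3 * d) mod (3 * d) = m mod (3 * d)" by simp
  moreover have "m mod (3 * d) mod 3 = m mod 3" by (simp add: mod_mod_cancel)
  ultimately show ?thesis using assms unfolding a_seq_def Let_def by auto
qed

theorem theorem1:
  fixes d m :: int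
  assumes "d \<ge> 1" and "m > 3 * d + 2"
  shows "a_seq d m = a_seq d (m - a_seq d (m - 1)) + a_seq d (m - a_seq d (m - 2))"
proof -
  define n k e where "n = m div (3 * d)" and "k = (m mod (3 * d)) div 3" and "e = m mod 3"
  have e: "0 \<le> e" "e < 3" by (simp_all add: e_def)
  have r: "0 \<le> m mod (3 * d)" "m mod (3 * d) < 3 * d" using assms(1) by simp_all
  have "m mod (3 * d) = 3 * k + e"
    using mult_div_mod_eq[of 3 "m mod (3 * d)"] by (simp add: k_def e_def mod_mod_cancel)
  then have m: "m = 3 * d * n + 3 * k + e"
    using mult_div_mod_eq[of "3 * d" m] by (simp add: n_def)
  have k: "0 \<le> k" "k < d" using r by (auto simp: k_def)
  have n: "n \<ge> 1" using assms by (simp add: n_def pos_imp_zdiv_pos_iff int_one_le_iff_zero_less)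
  \<comment> \<open>For \<open>n = 1\<close> and \<open>k = 0\<close>, \<open>m\<close> would be at
    most \<open>3 * d + 2\<close>. When \<open>e = 0\<close> this ensures that
    \<open>m - 3 * d\<close> exceeds 2.\<close>
  have n2: "n \<ge> 2" if "k = 0"
  proof (rule ccontr)
    assume "\<not> n \<ge> 2"
    then have "n = 1" using n by simp
    then show False using that m e assms(2) by simp
  qed
  have dn: "d * n \<ge> d" using n assms(1) by simp
  have prev: "a_seq d (m - 3 * d) = a_seq d (3 * d * (n - 1) + 3 * k + e)"
    by (simp add: m algebra_simps)
  have shift: "a_seq d (m - 3 * d) = a_seq d m" if "e \<noteq> 0"
    using that unfolding e_def by (rule a_seq_shift[OF assms])
  consider "e = 0" "k = 0" | "e = 0" "k \<ge> 1" | "e = 1" "k = 0" | "e = 1" "k \<ge> 1"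
    | "e = 2" "k = 0" | "e = 2" "k \<ge> 1"
    using e k by linarith
  then show ?thesis
  proof cases
    case 1
    have dn2: "d * (n - 1) \<ge> d" using n2 1 assms(1) by simp
    \<comment> \<open>Both predecessors lie in the previous block of length \<open>3 * d\<close>.
      The summands are the terms at \<open>m - 2\<close> and \<open>m - 3 * d\<close>, namely
      \<open>3 * d\<close> and \<open>3 * d * (n - 1)\<close>.\<close>
    have "m - 1 = 3 * d * (n - 1) + 3 * (d - 1) + 2" "m - 2 = 3 * d * (n - 1) + 3 * (d - 1) + 1"
      using 1 by (simp_all add: m algebra_simps)
    then have "a_seq d (m - 1) = 2" "a_seq d (m - 2) = 3 * d"
      using a_seq_eq[of "n - 1" "d - 1" d 2] a_seq_eq[of "n - 1" "d - 1" d 1] n assms dn2 by auto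
    moreover have "a_seq d m = 3 * d * n" "a_seq d (m - 3 * d) = 3 * d * (n - 1)"
      using a_seq_eq[of n 0 d 0] a_seq_eq[of "n - 1" 0 d 0] 1 n dn dn2 k assms m prev
      by (auto simp: p_poly_zero)
    ultimately show ?thesis by (simp add: algebra_simps)
  next
    case 2
    have "m - 1 = 3 * d * n + 3 * (k - 1) + 2" "m - 2 = 3 * d * n + 3 * (k - 1) + 1"
      "m - 3 = 3 * d * n + 3 * (k - 1) + 0"
      using 2 by (simp_all add: m algebra_simps)
    then have "a_seq d (m - 1) = 3" "a_seq d (m - 2) = 3 * d" "a_seq d (m - 3) = p_poly d (k - 1) n"
      using a_seq_eq[of n "k - 1" d 2] a_seq_eq[of n "k - 1" d 1] a_seq_eq[of n "k - 1" d 0]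
        2 n k dn assms by (auto simp: add_diff_eq)
    moreover have "a_seq d m = p_poly d k n" "a_seq d (m - 3 * d) = p_poly d k (n - 1)"
      using a_seq_eq[of n k d 0] a_seq_eq[of "n - 1" k d 0] 2 n dn k assms m prev
      by (auto simp: algebra_simps)
    ultimately show ?thesis using p_poly_rec[of k d n] 2 by simp
  next
    case 3
    \<comment> \<open>The summands are the terms at 1 and at \<open>m - 2\<close>: the value 2 at
      residue \<open>3 * d - 1\<close> makes up for the initial value
      \<open>3 * d - 2\<close>.\<close>
    have "m - 1 = 3 * d * n + 3 * 0 + 0" "m - 2 = 3 * d * (n - 1) + 3 * (d - 1) + 2"
      using 3 by (simp_all add: m algebra_simps)
    then have "a_seq d (m - 1) = 3 * d * n" "a_seq d (m - 2) = 2"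
      using a_seq_eq[of n 0 d 0] a_seq_eq[of "n - 1" "d - 1" d 2] n k dn assms
      by (auto simp: p_poly_zero)
    moreover have "a_seq d m = 3 * d"
      using a_seq_eq[of n 0 d 1] 3 n k dn assms m by auto
    moreover have "a_seq d 1 = 3 * d - 2" by (simp add: a_seq_def)
    ultimately show ?thesis using 3 m by simp
  next
    case 4
    have eqs: "m - 1 = 3 * d * n + 3 * k + 0" "m - 2 = 3 * d * n + 3 * (k - 1) + 2"
      "m - 3 = 3 * d * n + 3 * (k - 1) + 1"
      using 4 by (simp_all add: m algebra_simps)
    have "a_seq d (m - 1) = p_poly d k n" "a_seq d (m - 2) = 3" "a_seq d (m - 3) = 3 * d"
      unfolding eqs using a_seq_eq[of n k d 0] a_seq_eq[of n "k - 1" d 2] a_seq_eq[of n "k - 1" d 1]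
        4 n k dn assms by auto
    moreover have "a_seq d m = 3 * d"
      using a_seq_eq[of n k d 1] 4 n k dn assms m by auto
    moreover have "a_seq d (m - p_poly d k n) = 0"
      using p_poly_lower_bound[of d k n] 4 n assms m by (simp add: a_seq_def)
    ultimately show ?thesis by simp
  next
    case 5
    have eqs: "m - 1 = 3 * d * n + 3 * 0 + 1" "m - 2 = 3 * d * n + 3 * 0 + 0"
      using 5 by (simp_all add: m)
    have "a_seq d (m - 1) = 3 * d" "a_seq d (m - 2) = 3 * d * n"
      unfolding eqs using a_seq_eq[of n 0 d 1] a_seq_eq[of n 0 d 0] n k dn assms
      by (auto simp: p_poly_zero)
    moreover have "a_seq d 2 = 0" by (simp add: a_seq_def)
    ultimately show ?thesis using 5 m shift by simp
  next
    case 6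
    have eqs: "m - 1 = 3 * d * n + 3 * k + 1" "m - 2 = 3 * d * n + 3 * k + 0"
      using 6 by (simp_all add: m)
    have "a_seq d (m - 1) = 3 * d" "a_seq d (m - 2) = p_poly d k n"
      unfolding eqs using a_seq_eq[of n k d 1] a_seq_eq[of n k d 0] 6 n k dn assms by auto
    \<comment> \<open>Here \<open>m = 3 * d * n + 3 * k + 2\<close>, so the lower bound is used
      without slack.\<close>
    moreover have "a_seq d (m - p_poly d k n) = 0"
      using p_poly_lower_bound[of d k n] 6 n assms m by (simp add: a_seq_def)
    ultimately show ?thesis using 6 shift by simp
  qed
qed

end
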